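(* Let $n\ge1$ and let $\mathbb{W}^n=\{W\in[0,1]^{n\times n}: W\mathbf{1}=\mathbf{1},\ W^\top\mathbf{1}=\mathbf{1}\}$ be the set of doubly stochastic matrices. For a matrix norm $\|\cdot\|$ on $\mathbb{R}^{n\times n}$ define $d_{\mathbb{W}^n}(A,B)=\min_{W\in\mathbb{W}^n}\|AW-WB\|$ for $A,B\in\mathbb{R}^{n\times n}$. (i) If $\|\cdot\|$ is an arbitrary entry-wise $p$-norm, then $d_{\mathbb{W}^n}$ is a pseudometric on the set $\mathbb{S}^n$ of real symmetric $n\times n$ matrices. (ii) If $\|\cdot\|$ is an arbitrary entry-wise $p$-norm or operator $p$-norm, then the symmetric extension $\bar d_{\mathbb{W}^n}(A,B)=d_{\mathbb{W}^n}(A,B)+d_{\mathbb{W}^n}(B,A)$ is a pseudometric on $\mathbb{R}^{n\times n}$.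
   Context: $\mathbf{1}$ denotes the all-ones vector in $\mathbb{R}^n$. For $A=[a_{ij}]\in\mathbb{R}^{n\times n}$ and $p\in\{1,2,\dots\}\cup\{\infty\}$, the entry-wise $p$-norm is $\|A\|_p=(\sum_{i,j}|a_{ij}|^p)^{1/p}$ (and $\max_{i,j}|a_{ij}|$ for $p=\infty$); the operator $p$-norm is $\sup_{\|x\|_p=1}\|Ax\|_p$ with vector $p$-norms. A pseudometric on a set $\Omega$ is a function $d:\Omega\times\Omega\to\mathbb{R}$ with, for all $x,y,z\in\Omega$: $d(x,y)\ge0$, $d(x,x)=0$, $d(x,y)=d(y,x)$, $d(x,y)\le d(x,z)+d(z,y)$. *)

theory Defs
  imports "HOL-Analysis.Analysis" "HOL-Library.Extended_Nat"
begin

text \<open>In all norms below, the exponent \<open>p\<close> is meant to satisfy \<open>1 \<le> p\<close>.\<close>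

definition vec_pnorm :: "enat \<Rightarrow> real^'n \<Rightarrow> real" where
  "vec_pnorm p x = (case p of
      enat k \<Rightarrow> root k (\<Sum>i\<in>UNIV. \<bar>x $ i\<bar> ^ k)
    | \<infinity> \<Rightarrow> Max (range (\<lambda>i. \<bar>x $ i\<bar>)))"

definition entrywise_pnorm :: "enat \<Rightarrow> real^'n^'n \<Rightarrow> real" where
  "entrywise_pnorm p A = (case p of
      enat k \<Rightarrow> root k (\<Sum>i\<in>UNIV. \<Sum>j\<in>UNIV. \<bar>A $ i $ j\<bar> ^ k)
    | \<infinity> \<Rightarrow> Max (range (\<lambda>(i, j). \<bar>A $ i $ j\<bar>)))"

definition operator_pnorm :: "enat \<Rightarrow> real^'n^'n \<Rightarrow> real" where
  "operator_pnorm p A = (SUP x\<in>{x. vec_pnorm p x = 1}. vec_pnorm p (A *v x))"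

text \<open>The vector \<open>1 :: real^'n\<close> is the all-ones vector (see \<open>one_vec_def\<close>).\<close>

definition doubly_stochastic :: "(real^'n^'n) set" where
  "doubly_stochastic =
    {W. (\<forall>i j. W $ i $ j \<in> {0..1}) \<and> W *v 1 = 1 \<and> transpose W *v 1 = 1}"

text \<open>
  The minimum over the (infinite) set of doubly stochastic matrices is expressed by \<open>LEAST\<close>,
  which has the intended value only if the minimum is attained; \<open>Min\<close> is meaningful only for
  finite sets.
\<close>

definition ds_dist :: "(real^'n^'n \<Rightarrow> real) \<Rightarrow> real^'n^'n \<Rightarrow> real^'n^'n \<Rightarrow> real" where
  "ds_dist N A B = (LEAST m. \<exists>W\<in>doubly_stochastic. m = N (A ** W - W ** B))"

definition symmetric_extension :: "('a \<Rightarrow> 'a \<Rightarrow> real) \<Rightarrow> 'a \<Rightarrow> 'a \<Rightarrow> real" where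
  "symmetric_extension d x y = d x y + d y x"

definition pseudometric_on :: "'a set \<Rightarrow> ('a \<Rightarrow> 'a \<Rightarrow> real) \<Rightarrow> bool" where
  "pseudometric_on \<Omega> d \<longleftrightarrow>
    (\<forall>x\<in>\<Omega>. \<forall>y\<in>\<Omega>. \<forall>z\<in>\<Omega>.
      0 \<le> d x y \<and> d x x = 0 \<and> d x y = d y x \<and> d x y \<le> d x z + d z y)"

end

theory Submission
  imports Defs
begin

text \<open>
  If \<open>W\<^sub>1\<close> and \<open>W\<^sub>2\<close> attain the minima for \<open>(A, C)\<close> and \<open>(C, B)\<close>, then \<open>W\<^sub>1 W\<^sub>2\<close> is a doubly stochastic
  competitor for \<open>(A, B)\<close>, and
  \<open>A W\<^sub>1 W\<^sub>2 - W\<^sub>1 W\<^sub>2 B = (A W\<^sub>1 - W\<^sub>1 C) W\<^sub>2 + W\<^sub>1 (C W\<^sub>2 - W\<^sub>2 B)\<close>.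
  The triangle inequality follows because multiplication by a doubly stochastic matrix on either
  side does not increase the norm, which is Jensen's inequality for \<open>\<bar>t\<bar>\<^sup>p\<close>. For symmetric
  arguments, transposition exchanges the competitors for \<open>(A, B)\<close> and \<open>(B, A)\<close>.
\<close>

section \<open>The \<open>p\<close>-norm on functions with finite domain\<close>

text \<open>The index type is an arbitrary finite type, so one development serves vectors, indexed
  by \<open>'n\<close>, and matrices, indexed by pairs in \<open>'n \<times> 'n\<close>.\<close>

definition lp_norm :: "enat \<Rightarrow> ('i::finite \<Rightarrow> real) \<Rightarrow> real" where
  "lp_norm p f = (case p of
      enat k \<Rightarrow> root k (\<Sum>i\<in>UNIV. \<bar>f i\<bar> ^ k)
    | \<infinity> \<Rightarrow> Max (range (\<lambda>i. \<bar>f i\<bar>)))"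

lemma lp_norm_enat: "lp_norm (enat k) f = root k (\<Sum>i\<in>UNIV. \<bar>f i\<bar> ^ k)"
  by (simp add: lp_norm_def)

lemma lp_norm_infinity: "lp_norm \<infinity> f = Max (range (\<lambda>i. \<bar>f i\<bar>))"
  by (simp add: lp_norm_def)

lemma lp_norm_enat_le_iff:
  assumes "0 < k" "0 \<le> c"
  shows "lp_norm (enat k) f \<le> c \<longleftrightarrow> (\<Sum>i\<in>UNIV. \<bar>f i\<bar> ^ k) \<le> c ^ k"
  using assms real_root_le_iff[of k "\<Sum>i\<in>UNIV. \<bar>f i\<bar> ^ k" "c ^ k"]
  by (simp add: lp_norm_enat real_root_power_cancel)

lemma lp_norm_infinity_le_iff: "lp_norm \<infinity> f \<le> c \<longleftrightarrow> (\<forall>i. \<bar>f i\<bar> \<le> c)"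
  by (subst lp_norm_infinity, subst Max_le_iff) auto

lemma enat_ge_1_cases:
  assumes "1 \<le> (p::enat)"
  obtains k where "p = enat k" "0 < k" | "p = \<infinity>"
  using assms by (cases p) (auto simp: one_enat_def)

lemma abs_le_lp_norm:
  assumes "1 \<le> p"
  shows "\<bar>f i\<bar> \<le> lp_norm p f"
  using assms
proof (cases p rule: enat_ge_1_cases)
  case (1 k)
  have "\<bar>f i\<bar> ^ k \<le> (\<Sum>i\<in>UNIV. \<bar>f i\<bar> ^ k)"
    by (rule member_le_sum) auto
  then have "root k (\<bar>f i\<bar> ^ k) \<le> lp_norm p f"
    using 1 by (simp add: lp_norm_enat)
  then show ?thesis
    using 1 by (simp add: real_root_power_cancel)
next
  case 2
  then show ?thesis
    using lp_norm_infinity_le_iff[of f "lp_norm \<infinity> f"] by simp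
qed

lemma lp_norm_nonneg:
  assumes "1 \<le> p"
  shows "0 \<le> lp_norm p f"
  \<comment> \<open>\<open>undefined\<close> only names some index; every type is inhabited.\<close>
  using abs_le_lp_norm[OF assms, of f undefined] by linarith

lemma lp_norm_scale_le:
  assumes "1 \<le> p"
  shows "lp_norm p (\<lambda>i. c * f i) \<le> \<bar>c\<bar> * lp_norm p f"
  using assms
proof (cases p rule: enat_ge_1_cases)
  case (1 k)
  then show ?thesis
    by (simp add: lp_norm_enat abs_mult power_mult_distrib flip: sum_distrib_left)
       (simp add: real_root_mult real_root_power_cancel)
next
  case 2
  then show ?thesis
    using abs_le_lp_norm[OF assms, of f]
    by (simp add: lp_norm_infinity_le_iff abs_mult mult_left_mono)
qed

text \<open>Odd powers from 3 on are convex only on the half-line. Restricting to it treats both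
  parities at once, and later arguments are absolute values or nonnegative multiples of
  them.\<close>

lemma convex_on_power_nonneg: "convex_on {0::real..} (\<lambda>x. x ^ k)"
  using convex_power_odd[of k] convex_on_subset[OF convex_power_even[of k]] by (cases "even k") auto

text \<open>Rescaling reduces Minkowski's inequality to the convexity of the unit ball.\<close>

lemma lp_norm_triangle:
  fixes f g :: "'i::finite \<Rightarrow> real"
  assumes "1 \<le> p"
  shows "lp_norm p (\<lambda>i. f i + g i) \<le> lp_norm p f + lp_norm p g"
  using assms
proof (cases p rule: enat_ge_1_cases)
  case (1 k)
  show ?thesis
  proof (rule field_le_epsilon)
    fix e :: real
    assume "0 < e"
    \<comment> \<open>The padding \<open>e / 2\<close> keeps \<open>a\<close> and \<open>b\<close>
      positive even if a norm vanishes, so that division by them is safe.\<close>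
    define a where "a = lp_norm p f + e / 2"
    define b where "b = lp_norm p g + e / 2"
    have pos: "0 < a" "0 < b"
      using lp_norm_nonneg[OF assms, of f] lp_norm_nonneg[OF assms, of g] \<open>0 < e\<close>
      by (simp_all add: a_def b_def)
    have fa: "(\<Sum>i\<in>UNIV. \<bar>f i\<bar> ^ k) \<le> a ^ k"
      using lp_norm_enat_le_iff[of k a f] 1 pos \<open>0 < e\<close> by (simp add: a_def)
    have gb: "(\<Sum>i\<in>UNIV. \<bar>g i\<bar> ^ k) \<le> b ^ k"
      using lp_norm_enat_le_iff[of k b g] 1 pos \<open>0 < e\<close> by (simp add: b_def)
    \<comment> \<open>With these weights, \<open>\<bar>f i\<bar> + \<bar>g i\<bar>\<close> is
      \<open>a + b\<close> times a convex combination of the rescaled values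
      \<open>\<bar>f i\<bar> / a\<close> and \<open>\<bar>g i\<bar> / b\<close>.\<close>
    define u where "u = a / (a + b)"
    define v where "v = b / (a + b)"
    have uv: "0 \<le> u" "0 \<le> v" "u + v = 1"
      using pos by (auto simp: u_def v_def simp flip: add_divide_distrib)
    have pointwise: "\<bar>f i + g i\<bar> ^ k \<le>
        (a + b) ^ k * (u * (\<bar>f i\<bar> ^ k / a ^ k) + v * (\<bar>g i\<bar> ^ k / b ^ k))" for i
    proof -
      have "\<bar>f i + g i\<bar> \<le> \<bar>f i\<bar> + \<bar>g i\<bar>"
        by simp
      also have "\<dots> = (a + b) * (u * (\<bar>f i\<bar> / a) + v * (\<bar>g i\<bar> / b))"
        using pos by (simp add: u_def v_def distrib_left)
      finally have "\<bar>f i + g i\<bar> ^ k \<le> ((a + b) * (u * (\<bar>f i\<bar> / a) + v * (\<bar>g i\<bar> / b))) ^ k"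
        by (simp add: power_mono)
      also have "\<dots> = (a + b) ^ k * (u * (\<bar>f i\<bar> / a) + v * (\<bar>g i\<bar> / b)) ^ k"
        by (simp add: power_mult_distrib)
      also have "(u * (\<bar>f i\<bar> / a) + v * (\<bar>g i\<bar> / b)) ^ k \<le>
          u * (\<bar>f i\<bar> / a) ^ k + v * (\<bar>g i\<bar> / b) ^ k"
        using convex_on_power_nonneg[of k, unfolded convex_on_def, THEN conjunct2,
            rule_format, of "\<bar>f i\<bar> / a" "\<bar>g i\<bar> / b" u v] uv pos
        by simp
      finally show ?thesis
        using pos by (simp add: power_divide)
    qed
    have "(\<Sum>i\<in>UNIV. \<bar>f i + g i\<bar> ^ k) \<le>
        (\<Sum>i\<in>UNIV. (a + b) ^ k * (u * (\<bar>f i\<bar> ^ k / a ^ k) + v * (\<bar>g i\<bar> ^ k / b ^ k)))"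
      by (intro sum_mono pointwise)
    also have "\<dots> = (a + b) ^ k *
        (u * ((\<Sum>i\<in>UNIV. \<bar>f i\<bar> ^ k) / a ^ k) + v * ((\<Sum>i\<in>UNIV. \<bar>g i\<bar> ^ k) / b ^ k))"
      by (simp add: sum.distrib sum_divide_distrib sum_distrib_left distrib_left)
    also have "\<dots> \<le> (a + b) ^ k * (u * 1 + v * 1)"
      using fa gb uv pos by (intro mult_left_mono add_mono) auto
    also have "\<dots> = (a + b) ^ k"
      using uv by simp
    finally have "lp_norm p (\<lambda>i. f i + g i) \<le> a + b"
      using lp_norm_enat_le_iff[of k "a + b" "\<lambda>i. f i + g i"] 1 pos by simp
    then show "lp_norm p (\<lambda>i. f i + g i) \<le> lp_norm p f + lp_norm p g + e"
      by (simp add: a_def b_def)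
  qed
next
  case 2
  have "\<bar>f i + g i\<bar> \<le> lp_norm p f + lp_norm p g" for i
    using abs_le_lp_norm[OF assms, of f i] abs_le_lp_norm[OF assms, of g i] by linarith
  then show ?thesis
    using 2 by (simp add: lp_norm_infinity_le_iff)
qed

text \<open>Row sums 1 make each new value a weighted average of the old ones. For finite
  \<open>p\<close>, Jensen bounds its power by the average of the powers, and after exchanging the
  sums the column sums remove the weights. For infinite \<open>p\<close>, an average cannot exceed
  the maximum.\<close>

lemma lp_norm_stochastic_kernel_le:
  fixes K :: "'i::finite \<Rightarrow> 'i \<Rightarrow> real"
  assumes "1 \<le> p"
    and nonneg: "\<And>i j. 0 \<le> K i j"
    and rows: "\<And>i. (\<Sum>j\<in>UNIV. K i j) = 1"
    and columns: "\<And>j. (\<Sum>i\<in>UNIV. K i j) = 1"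
  shows "lp_norm p (\<lambda>i. \<Sum>j\<in>UNIV. K i j * f j) \<le> lp_norm p f"
proof -
  have abs_le: "\<bar>\<Sum>j\<in>UNIV. K i j * f j\<bar> \<le> (\<Sum>j\<in>UNIV. K i j * \<bar>f j\<bar>)" for i
    using sum_abs[of "\<lambda>j. K i j * f j" UNIV] nonneg by (simp add: abs_mult)
  show ?thesis
    using \<open>1 \<le> p\<close>
  proof (cases p rule: enat_ge_1_cases)
    case (1 k)
    have "\<bar>\<Sum>j\<in>UNIV. K i j * f j\<bar> ^ k \<le> (\<Sum>j\<in>UNIV. K i j * \<bar>f j\<bar> ^ k)" for i
    proof -
      have "\<bar>\<Sum>j\<in>UNIV. K i j * f j\<bar> ^ k \<le> (\<Sum>j\<in>UNIV. K i j * \<bar>f j\<bar>) ^ k"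
        by (intro power_mono abs_le) simp
      also have "\<dots> \<le> (\<Sum>j\<in>UNIV. K i j * \<bar>f j\<bar> ^ k)"
        using convex_on_sum[OF _ _ convex_on_power_nonneg[of k], of UNIV "K i" "\<lambda>j. \<bar>f j\<bar>"] nonneg rows
        by simp
      finally show ?thesis .
    qed
    then have "(\<Sum>i\<in>UNIV. \<bar>\<Sum>j\<in>UNIV. K i j * f j\<bar> ^ k) \<le>
        (\<Sum>i\<in>UNIV. \<Sum>j\<in>UNIV. K i j * \<bar>f j\<bar> ^ k)"
      by (intro sum_mono)
    also have "\<dots> = (\<Sum>j\<in>UNIV. \<Sum>i\<in>UNIV. K i j * \<bar>f j\<bar> ^ k)"
      by (rule sum.swap)
    also have "\<dots> = (\<Sum>j\<in>UNIV. \<bar>f j\<bar> ^ k)"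
      by (simp add: columns flip: sum_distrib_right)
    finally show ?thesis
      using 1 by (simp add: lp_norm_enat)
  next
    case 2
    have "\<bar>\<Sum>j\<in>UNIV. K i j * f j\<bar> \<le> lp_norm p f" for i
    proof -
      note abs_le[of i]
      also have "(\<Sum>j\<in>UNIV. K i j * \<bar>f j\<bar>) \<le> (\<Sum>j\<in>UNIV. K i j * lp_norm p f)"
        by (intro sum_mono mult_left_mono abs_le_lp_norm[OF \<open>1 \<le> p\<close>] nonneg)
      also have "\<dots> = lp_norm p f"
        by (simp add: rows flip: sum_distrib_right)
      finally show ?thesis .
    qed
    then show ?thesis
      using 2 by (simp add: lp_norm_infinity_le_iff)
  qed
qed

section \<open>Doubly stochastic matrices\<close>

lemma doubly_stochastic_iff:
  "W \<in> doubly_stochastic \<longleftrightarrow>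
    (\<forall>i j. 0 \<le> W $ i $ j) \<and> (\<forall>i. (\<Sum>j\<in>UNIV. W $ i $ j) = 1) \<and> (\<forall>j. (\<Sum>i\<in>UNIV. W $ i $ j) = 1)"
proof -
  \<comment> \<open>A nonnegative entry is at most its row sum, which recovers the upper bound in
    the definition.\<close>
  have "W $ i $ j \<le> 1" if "\<forall>i j. 0 \<le> W $ i $ j" "\<forall>i. (\<Sum>j\<in>UNIV. W $ i $ j) = 1" for i j
    using member_le_sum[of j UNIV "\<lambda>j. W $ i $ j"] that by simp
  then show ?thesis
    unfolding doubly_stochastic_def
    by (auto simp: vec_eq_iff matrix_vector_mult_def transpose_def)
qed

lemma mat_1_in_doubly_stochastic: "mat 1 \<in> doubly_stochastic"
  by (auto simp: doubly_stochastic_iff mat_def)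

lemma transpose_in_doubly_stochastic:
  "W \<in> doubly_stochastic \<Longrightarrow> transpose W \<in> doubly_stochastic"
  by (auto simp: doubly_stochastic_iff transpose_def)

lemma matrix_mul_in_doubly_stochastic:
  assumes "V \<in> doubly_stochastic" "W \<in> doubly_stochastic"
  shows "V ** W \<in> doubly_stochastic"
proof -
  have "(V ** W) *v 1 = 1" "transpose (V ** W) *v 1 = 1"
    using assms
    by (simp_all add: doubly_stochastic_def matrix_transpose_mul flip: matrix_vector_mul_assoc)
  moreover have "0 \<le> (V ** W) $ i $ j" for i j
    using assms by (auto simp: doubly_stochastic_iff matrix_matrix_mult_def intro!: sum_nonneg)
  ultimately show ?thesis
    by (simp add: doubly_stochastic_iff vec_eq_iff matrix_vector_mult_def transpose_def)
qed

text \<open>Compactness is what guarantees that the minimum behind \<open>LEAST\<close> is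
  attained.\<close>

lemma compact_doubly_stochastic: "compact (doubly_stochastic :: (real^'n^'n) set)"
proof -
  have "bounded (doubly_stochastic :: (real^'n^'n) set)"
  proof (rule boundedI)
    fix W :: "real^'n^'n"
    assume W: "W \<in> doubly_stochastic"
    have "norm W \<le> (\<Sum>i\<in>UNIV. norm (W $ i))"
      by (simp add: norm_vec_def L2_set_le_sum)
    also have "\<dots> \<le> (\<Sum>i\<in>UNIV. \<Sum>j\<in>UNIV. \<bar>W $ i $ j\<bar>)"
      by (intro sum_mono norm_le_l1_cart)
    \<comment> \<open>All entries are nonnegative and each of the \<open>CARD('n)\<close> rows has
      sum 1.\<close>
    also have "\<dots> = real CARD('n)"
      using W by (simp add: doubly_stochastic_iff)
    finally show "norm W \<le> real CARD('n)" .
  qed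
  moreover have "closed (doubly_stochastic :: (real^'n^'n) set)"
  proof -
    have eq: "doubly_stochastic = {W :: real^'n^'n.
      (\<forall>i j. 0 \<le> W $ i $ j) \<and> (\<forall>i. (\<Sum>j\<in>UNIV. W $ i $ j) = 1) \<and> (\<forall>j. (\<Sum>i\<in>UNIV. W $ i $ j) = 1)}"
      by (auto simp: doubly_stochastic_iff)
    show ?thesis
      unfolding eq by (intro closed_Collect_conj closed_Collect_all closed_Collect_le closed_Collect_eq
          continuous_intros)
  qed
  ultimately show ?thesis
    by (simp add: compact_eq_bounded_closed)
qed

section \<open>Norms not increased by doubly stochastic matrices\<close>

lemma matrix_diff_ldistrib: "A ** (B - C) = A ** B - A ** (C :: 'a::ring_1^'n^'m)"
  by (simp add: matrix_matrix_mult_def vec_eq_iff right_diff_distrib sum_subtractf)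

lemma matrix_diff_rdistrib: "(B - C) ** A = B ** A - C ** (A :: 'a::ring_1^'n^'m)"
  by (simp add: matrix_matrix_mult_def vec_eq_iff left_diff_distrib sum_subtractf)

text \<open>Collects what the metric argument uses of a norm, so that entrywise and operator norms
  are treated together. The inequality \<open>scale_le\<close> is enough to derive
  \<open>zero\<close>, \<open>uminus\<close> and \<open>nonneg\<close> with the help of
  \<open>triangle\<close>.\<close>

locale doubly_stochastic_contractive =
  fixes N :: "real^'n^'n \<Rightarrow> real"
  assumes scale_le: "N (c *\<^sub>R X) \<le> \<bar>c\<bar> * N X"
    and triangle: "N (X + Y) \<le> N X + N Y"
    and left_le: "W \<in> doubly_stochastic \<Longrightarrow> N (W ** X) \<le> N X"
    and right_le: "W \<in> doubly_stochastic \<Longrightarrow> N (X ** W) \<le> N X"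
begin

lemma zero: "N 0 = 0"
  using scale_le[of 0 0] triangle[of 0 0] by simp

lemma uminus: "N (- X) = N X"
  using scale_le[of "-1" X] scale_le[of "-1" "-X"] by simp

lemma nonneg: "0 \<le> N X"
  using triangle[of X "- X"] by (simp add: zero uminus)

text \<open>Homogeneity and the triangle inequality make \<open>N\<close> convex, and a convex
  function on a finite-dimensional space is continuous.\<close>

lemma continuous_on_norm: "continuous_on UNIV N"
proof (intro convex_on_continuous convex_onI)
  fix t :: real and X Y :: "real^'n^'n"
  assume "0 < t" "t < 1"
  then show "N ((1 - t) *\<^sub>R X + t *\<^sub>R Y) \<le> (1 - t) * N X + t * N Y"
    using triangle[of "(1 - t) *\<^sub>R X" "t *\<^sub>R Y"] scale_le[of "1 - t" X] scale_le[of t Y] by simp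
qed auto

section \<open>Attainment of the minimum and metric properties of \<open>ds_dist\<close>\<close>

lemma ds_dist_attained:
  obtains W where "W \<in> doubly_stochastic" "ds_dist N A B = N (A ** W - W ** B)"
    "\<And>V. V \<in> doubly_stochastic \<Longrightarrow> ds_dist N A B \<le> N (A ** V - V ** B)"
proof -
  have "continuous_on doubly_stochastic (\<lambda>W. A ** W - W ** B)"
    unfolding matrix_matrix_mult_def by (intro continuous_intros)
  then have "continuous_on doubly_stochastic (\<lambda>W. N (A ** W - W ** B))"
    by (rule continuous_on_compose2[OF continuous_on_norm]) simp
  \<comment> \<open>A continuous function attains its infimum on a nonempty compact set; the
    identity matrix shows nonemptiness.\<close>
  then obtain W where W: "W \<in> doubly_stochastic"
    "\<forall>V\<in>doubly_stochastic. N (A ** W - W ** B) \<le> N (A ** V - V ** B)"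
    using continuous_attains_inf[OF compact_doubly_stochastic] mat_1_in_doubly_stochastic by blast
  then have "ds_dist N A B = N (A ** W - W ** B)"
    unfolding ds_dist_def by (intro Least_equality) auto
  with W that show ?thesis
    by metis
qed

lemma ds_dist_le:
  assumes "W \<in> doubly_stochastic"
  shows "ds_dist N A B \<le> N (A ** W - W ** B)"
  using ds_dist_attained[of A B] assms by metis

lemma ds_dist_nonneg: "0 \<le> ds_dist N A B"
  by (rule ds_dist_attained[of A B]) (simp add: nonneg)

lemma ds_dist_self: "ds_dist N A A = 0"
  using ds_dist_le[OF mat_1_in_doubly_stochastic, of A A] ds_dist_nonneg[of A A]
  by (simp add: zero)

lemma ds_dist_triangle: "ds_dist N A B \<le> ds_dist N A C + ds_dist N C B"
proof -
  obtain V where V: "V \<in> doubly_stochastic" "ds_dist N A C = N (A ** V - V ** C)"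
    using ds_dist_attained[of A C] .
  obtain W where W: "W \<in> doubly_stochastic" "ds_dist N C B = N (C ** W - W ** B)"
    using ds_dist_attained[of C B] .
  have "ds_dist N A B \<le> N (A ** (V ** W) - V ** W ** B)"
    by (intro ds_dist_le matrix_mul_in_doubly_stochastic V W)
  \<comment> \<open>The mixed term \<open>V ** C ** W\<close> is subtracted and added back.\<close>
  also have "A ** (V ** W) - V ** W ** B = (A ** V - V ** C) ** W + V ** (C ** W - W ** B)"
    by (simp add: matrix_mul_assoc matrix_diff_ldistrib matrix_diff_rdistrib)
  also have "N \<dots> \<le> N ((A ** V - V ** C) ** W) + N (V ** (C ** W - W ** B))"
    by (rule triangle)
  also have "\<dots> \<le> N (A ** V - V ** C) + N (C ** W - W ** B)"
    by (intro add_mono left_le right_le V W)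
  finally show ?thesis
    using V W by simp
qed

text \<open>Symmetry holds by construction. The triangle inequality is the sum of two instances for
  \<open>ds_dist N\<close>, one for each direction between \<open>A\<close> and \<open>B\<close>,
  through the same \<open>C\<close>.\<close>

lemma pseudometric_on_symmetric_extension:
  "pseudometric_on UNIV (symmetric_extension (ds_dist N))"
  unfolding pseudometric_on_def symmetric_extension_def
proof (intro ballI conjI)
  fix A B C :: "real^'n^'n"
  show "ds_dist N A B + ds_dist N B A \<le>
      ds_dist N A C + ds_dist N C A + (ds_dist N C B + ds_dist N B C)"
    using ds_dist_triangle[of A B C] ds_dist_triangle[of B A C] by linarith
qed (simp_all add: ds_dist_nonneg ds_dist_self)

text \<open>Invariance under transposition is what makes \<open>ds_dist N\<close> itself symmetric
  here; operator p-norms lack it in general.\<close>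

lemma pseudometric_on_symmetric_matrices:
  assumes transpose: "\<And>X. N (transpose X) = N X"
  shows "pseudometric_on {A. transpose A = A} (ds_dist N)"
proof -
  have le: "ds_dist N A B \<le> ds_dist N B A" if "transpose A = A" "transpose B = B" for A B
  proof -
    obtain W where W: "W \<in> doubly_stochastic" "ds_dist N B A = N (B ** W - W ** A)"
      using ds_dist_attained[of B A] .
    have "ds_dist N A B \<le> N (A ** transpose W - transpose W ** B)"
      by (intro ds_dist_le transpose_in_doubly_stochastic W)
    \<comment> \<open>Transposition reverses products and fixes \<open>A\<close> and
      \<open>B\<close>, which swaps the two terms; the minus sign restores their order.\<close>
    also have "A ** transpose W - transpose W ** B = - transpose (B ** W - W ** A)"
      using that matrix_transpose_mul[of B W] matrix_transpose_mul[of W A]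
      by (simp add: transpose_def vec_eq_iff)
    finally show ?thesis
      by (simp add: W uminus transpose)
  qed
  show ?thesis
    unfolding pseudometric_on_def
    using le by (auto simp: ds_dist_nonneg ds_dist_self ds_dist_triangle intro: antisym)
qed

end

section \<open>Entrywise and operator norms\<close>

lemma entrywise_pnorm_eq_lp_norm:
  "entrywise_pnorm p A = lp_norm p (\<lambda>ij. A $ fst ij $ snd ij)"
  by (simp add: entrywise_pnorm_def lp_norm_def sum.cartesian_product case_prod_beta split: enat.split)

lemma entrywise_pnorm_transpose: "entrywise_pnorm p (transpose A) = entrywise_pnorm p A"
proof -
  have "range (\<lambda>(i, j). \<bar>A $ j $ i\<bar>) = range (\<lambda>(i, j). \<bar>A $ i $ j\<bar>)"
    by auto
  then show ?thesis
    unfolding entrywise_pnorm_def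
    by (auto simp: transpose_def intro: arg_cong[OF sum.swap] split: enat.split)
qed

lemma entrywise_pnorm_doubly_stochastic_left_le:
  fixes W X :: "real^'n^'n"
  assumes "1 \<le> p" "W \<in> doubly_stochastic"
  shows "entrywise_pnorm p (W ** X) \<le> entrywise_pnorm p X"
proof -
  \<comment> \<open>\<open>K\<close> is the Kronecker product of \<open>W\<close> with the identity:
    left multiplication by \<open>W\<close> mixes row indices and keeps the column index. Its row
    and column sums are those of \<open>W\<close>.\<close>
  define K where "K = (\<lambda>(ij :: 'n \<times> 'n) (kl :: 'n \<times> 'n). if snd ij = snd kl then W $ fst ij $ fst kl else 0)"
  have "(W ** X) $ fst ij $ snd ij = (\<Sum>kl\<in>UNIV. K ij kl * X $ fst kl $ snd kl)" for ij
    by (simp add: K_def matrix_matrix_mult_def sum.cartesian_product' if_distrib[of "\<lambda>x. x * _"]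
        cong: if_cong flip: UNIV_Times_UNIV)
  moreover have "lp_norm p (\<lambda>ij. \<Sum>kl\<in>UNIV. K ij kl * X $ fst kl $ snd kl) \<le>
      lp_norm p (\<lambda>ij. X $ fst ij $ snd ij)"
    using assms by (intro lp_norm_stochastic_kernel_le)
      (auto simp: K_def doubly_stochastic_iff sum.cartesian_product' simp flip: UNIV_Times_UNIV)
  ultimately show ?thesis
    by (simp add: entrywise_pnorm_eq_lp_norm)
qed

lemma doubly_stochastic_contractive_entrywise_pnorm:
  assumes "1 \<le> p"
  shows "doubly_stochastic_contractive (entrywise_pnorm p)"
proof
  fix c :: real and W X Y :: "real^'n^'n"
  show "entrywise_pnorm p (c *\<^sub>R X) \<le> \<bar>c\<bar> * entrywise_pnorm p X"
    using lp_norm_scale_le[OF assms] by (simp add: entrywise_pnorm_eq_lp_norm)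
  show "entrywise_pnorm p (X + Y) \<le> entrywise_pnorm p X + entrywise_pnorm p Y"
    using lp_norm_triangle[OF assms] by (simp add: entrywise_pnorm_eq_lp_norm)
  assume W: "W \<in> doubly_stochastic"
  show "entrywise_pnorm p (W ** X) \<le> entrywise_pnorm p X"
    using assms W by (rule entrywise_pnorm_doubly_stochastic_left_le)
  show "entrywise_pnorm p (X ** W) \<le> entrywise_pnorm p X"
    \<comment> \<open>\<open>X ** W\<close> is the transpose of
      \<open>transpose W ** transpose X\<close>, which reduces right multiplication to left
      multiplication.\<close>
    using entrywise_pnorm_doubly_stochastic_left_le[OF assms transpose_in_doubly_stochastic[OF W],
        of "transpose X"]
    by (simp add: entrywise_pnorm_transpose flip: matrix_transpose_mul)
qed

section \<open>Vector p-norms and the operator norms they induce\<close>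

lemma vec_pnorm_eq_lp_norm: "vec_pnorm p x = lp_norm p (\<lambda>i. x $ i)"
  by (simp add: vec_pnorm_def lp_norm_def)

lemma vec_pnorm_nonneg: "1 \<le> p \<Longrightarrow> 0 \<le> vec_pnorm p x"
  by (simp add: vec_pnorm_eq_lp_norm lp_norm_nonneg)

lemma vec_pnorm_scale_le: "1 \<le> p \<Longrightarrow> vec_pnorm p (c *\<^sub>R x) \<le> \<bar>c\<bar> * vec_pnorm p x"
  using lp_norm_scale_le by (simp add: vec_pnorm_eq_lp_norm)

lemma vec_pnorm_triangle: "1 \<le> p \<Longrightarrow> vec_pnorm p (x + y) \<le> vec_pnorm p x + vec_pnorm p y"
  using lp_norm_triangle by (simp add: vec_pnorm_eq_lp_norm)

lemma vec_pnorm_zero: "1 \<le> p \<Longrightarrow> vec_pnorm p (0 :: real^'n) = 0"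
  using vec_pnorm_scale_le[of p 0 "0 :: real^'n"] vec_pnorm_nonneg[of p "0 :: real^'n"] by simp

lemma vec_pnorm_scale:
  assumes "1 \<le> p"
  shows "vec_pnorm p (c *\<^sub>R x) = \<bar>c\<bar> * vec_pnorm p x"
proof (cases "c = 0")
  case False
  \<comment> \<open>Scaling back by \<open>inverse c\<close> gives the reverse of
    \<open>vec_pnorm_scale_le\<close>.\<close>
  have "\<bar>c\<bar> * vec_pnorm p x = \<bar>c\<bar> * vec_pnorm p (inverse c *\<^sub>R c *\<^sub>R x)"
    using False by simp
  also have "\<dots> \<le> \<bar>c\<bar> * (\<bar>inverse c\<bar> * vec_pnorm p (c *\<^sub>R x))"
    by (intro mult_left_mono vec_pnorm_scale_le assms) simp
  also have "\<dots> = vec_pnorm p (c *\<^sub>R x)"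
    using False by (simp flip: mult.assoc abs_mult)
  finally show ?thesis
    using vec_pnorm_scale_le[OF assms, of c x] by simp
qed (simp add: vec_pnorm_zero assms)

lemma vec_pnorm_sum:
  assumes "1 \<le> p"
  shows "vec_pnorm p (\<Sum>i\<in>S. f i) \<le> (\<Sum>i\<in>S. vec_pnorm p (f i))"
proof (induction S rule: infinite_finite_induct)
  case (insert i S)
  then show ?case
    using vec_pnorm_triangle[OF assms, of "f i" "sum f S"] by simp
qed (simp_all add: vec_pnorm_zero assms)

lemma vec_pnorm_eq_0_imp: "1 \<le> p \<Longrightarrow> vec_pnorm p x = 0 \<Longrightarrow> x = 0"
  using abs_le_lp_norm[of p "\<lambda>i. x $ i"] by (simp add: vec_pnorm_eq_lp_norm vec_eq_iff)

lemma vec_pnorm_doubly_stochastic_le: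
  assumes "1 \<le> p" "W \<in> doubly_stochastic"
  shows "vec_pnorm p (W *v x) \<le> vec_pnorm p x"
  using assms lp_norm_stochastic_kernel_le[of p "\<lambda>i j. W $ i $ j" "\<lambda>i. x $ i"]
  by (simp add: vec_pnorm_eq_lp_norm matrix_vector_mult_def doubly_stochastic_iff)

text \<open>A real supremum is meaningful only over a nonempty bounded set. The normalised all-ones
  vector settles nonemptiness for \<open>operator_pnorm\<close>.\<close>

lemma unit_pnorm_sphere_nonempty:
  assumes "1 \<le> p"
  shows "{x :: real^'n. vec_pnorm p x = 1} \<noteq> {}"
proof -
  define c where "c = vec_pnorm p (1 :: real^'n)"
  have "c \<noteq> 0"
    using vec_pnorm_eq_0_imp[OF assms, of "1 :: real^'n"] by (auto simp: c_def)
  then have "vec_pnorm p (inverse c *\<^sub>R (1 :: real^'n)) = 1"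
    using vec_pnorm_nonneg[OF assms, of "1 :: real^'n"]
    by (simp add: vec_pnorm_scale[OF assms] flip: c_def)
  then show ?thesis
    by blast
qed

text \<open>\<open>A *v x\<close> combines the columns of \<open>A\<close> with the coordinates of
  \<open>x\<close> as coefficients. These are at most 1 in absolute value on the unit sphere, so the
  sum of the column norms is a bound.\<close>

lemma bdd_above_operator_pnorm:
  fixes A :: "real^'n^'m"
  assumes "1 \<le> p"
  shows "bdd_above ((\<lambda>x. vec_pnorm p (A *v x)) ` {x. vec_pnorm p x = 1})"
proof (rule bdd_aboveI2)
  fix x :: "real^'n"
  assume "x \<in> {x. vec_pnorm p x = 1}"
  then have x: "\<bar>x $ j\<bar> \<le> 1" for j
    using abs_le_lp_norm[OF assms, of "\<lambda>i. x $ i" j] by (simp add: vec_pnorm_eq_lp_norm)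
  have "vec_pnorm p (A *v x) \<le> (\<Sum>j\<in>UNIV. vec_pnorm p (x $ j *\<^sub>R column j A))"
    by (simp add: matrix_mult_sum scalar_mult_eq_scaleR vec_pnorm_sum assms)
  also have "\<dots> \<le> (\<Sum>j\<in>UNIV. vec_pnorm p (column j A))"
    using x by (intro sum_mono)
      (simp add: vec_pnorm_scale[OF assms] mult_left_le_one_le vec_pnorm_nonneg[OF assms])
  finally show "vec_pnorm p (A *v x) \<le> (\<Sum>j\<in>UNIV. vec_pnorm p (column j A))" .
qed

lemma vec_pnorm_mult_le:
  assumes "1 \<le> p"
  shows "vec_pnorm p (A *v x) \<le> operator_pnorm p A * vec_pnorm p x"
proof (cases "x = 0")
  case False
  define c where "c = vec_pnorm p x"
  have "0 < c"
    using vec_pnorm_eq_0_imp[OF assms] vec_pnorm_nonneg[OF assms, of x] False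
    by (force simp: c_def)
  then have "vec_pnorm p (inverse c *\<^sub>R x) = 1"
    by (simp add: vec_pnorm_scale[OF assms] flip: c_def)
  then have "vec_pnorm p (A *v (inverse c *\<^sub>R x)) \<le> operator_pnorm p A"
    unfolding operator_pnorm_def by (intro cSUP_upper bdd_above_operator_pnorm assms) simp
  then show ?thesis
    using \<open>0 < c\<close>
    by (simp add: matrix_vector_mult_scaleR vec_pnorm_scale[OF assms] field_simps flip: c_def)
qed (simp add: vec_pnorm_zero assms)

lemma operator_pnorm_le:
  assumes "1 \<le> p" "\<And>x. vec_pnorm p x = 1 \<Longrightarrow> vec_pnorm p (A *v x) \<le> c"
  shows "operator_pnorm p A \<le> c"
  unfolding operator_pnorm_def
  using assms by (intro cSUP_least unit_pnorm_sphere_nonempty) auto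

lemma operator_pnorm_nonneg:
  assumes "1 \<le> p"
  shows "0 \<le> operator_pnorm p (A :: real^'n^'n)"
proof -
  obtain x :: "real^'n" where "vec_pnorm p x = 1"
    using unit_pnorm_sphere_nonempty[OF assms] by blast
  then show ?thesis
    using vec_pnorm_mult_le[OF assms, of A x] vec_pnorm_nonneg[OF assms, of "A *v x"] by simp
qed

lemma doubly_stochastic_contractive_operator_pnorm:
  assumes "1 \<le> p"
  shows "doubly_stochastic_contractive (operator_pnorm p)"
proof
  note unit_le = vec_pnorm_mult_le[OF assms]
  fix c :: real and W X Y :: "real^'n^'n"
  show "operator_pnorm p (c *\<^sub>R X) \<le> \<bar>c\<bar> * operator_pnorm p X"
  proof (rule operator_pnorm_le[OF assms])
    fix x :: "real^'n"
    assume "vec_pnorm p x = 1"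
    then show "vec_pnorm p (c *\<^sub>R X *v x) \<le> \<bar>c\<bar> * operator_pnorm p X"
      using unit_le[of X x]
      by (simp add: vec_pnorm_scale[OF assms] mult_left_mono flip: scaleR_matrix_vector_assoc)
  qed
  show "operator_pnorm p (X + Y) \<le> operator_pnorm p X + operator_pnorm p Y"
  proof (rule operator_pnorm_le[OF assms])
    fix x :: "real^'n"
    assume "vec_pnorm p x = 1"
    then show "vec_pnorm p ((X + Y) *v x) \<le> operator_pnorm p X + operator_pnorm p Y"
      using unit_le[of X x] unit_le[of Y x] vec_pnorm_triangle[OF assms, of "X *v x" "Y *v x"]
      by (simp add: matrix_vector_mult_add_rdistrib)
  qed
  assume W: "W \<in> doubly_stochastic"
  show "operator_pnorm p (W ** X) \<le> operator_pnorm p X"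
  proof (rule operator_pnorm_le[OF assms])
    fix x :: "real^'n"
    assume "vec_pnorm p x = 1"
    then show "vec_pnorm p ((W ** X) *v x) \<le> operator_pnorm p X"
      using unit_le[of X x] vec_pnorm_doubly_stochastic_le[OF assms W, of "X *v x"]
      by (simp flip: matrix_vector_mul_assoc)
  qed
  show "operator_pnorm p (X ** W) \<le> operator_pnorm p X"
  proof (rule operator_pnorm_le[OF assms])
    fix x :: "real^'n"
    assume x: "vec_pnorm p x = 1"
    \<comment> \<open>\<open>W *v x\<close> may leave the unit sphere, so the homogeneous bound for
      arbitrary vectors is applied; its norm is still at most 1.\<close>
    have "vec_pnorm p (X *v (W *v x)) \<le> operator_pnorm p X * vec_pnorm p (W *v x)"
      by (rule unit_le)
    also have "\<dots> \<le> operator_pnorm p X * 1"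
      using vec_pnorm_doubly_stochastic_le[OF assms W, of x] x
      by (intro mult_left_mono operator_pnorm_nonneg assms) simp
    finally show "vec_pnorm p ((X ** W) *v x) \<le> operator_pnorm p X"
      by (simp flip: matrix_vector_mul_assoc)
  qed
qed

theorem theorem2:
  shows "(\<forall>p::enat. 1 \<le> p \<longrightarrow>
            pseudometric_on {A :: real^'n^'n. transpose A = A} (ds_dist (entrywise_pnorm p))) \<and>
         (\<forall>(p::enat) (N :: real^'n^'n \<Rightarrow> real).
            1 \<le> p \<and> (N = entrywise_pnorm p \<or> N = operator_pnorm p) \<longrightarrow>
            pseudometric_on (UNIV :: (real^'n^'n) set) (symmetric_extension (ds_dist N)))"
  by (auto intro!: doubly_stochastic_contractive.pseudometric_on_symmetric_matrices
      doubly_stochastic_contractive.pseudometric_on_symmetric_extension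
      doubly_stochastic_contractive_entrywise_pnorm doubly_stochastic_contractive_operator_pnorm
      entrywise_pnorm_transpose)

end
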